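(* For all $0<\lambda_1<\lambda_2<\infty$ and $p=\left(\frac{\lambda_2-\lambda_1}{\lambda_2+\lambda_1}\right)^2$, $$\mathrm{E}[\lambda_1]\ast\mathrm{E}[\lambda_2]=(1-p)\sum_{k=0}^\infty p^k\,\mathrm{E}^{\ast 2(k+1)}\left[\tfrac12(\lambda_2+\lambda_1)\right],$$ as an equality of probability measures.
   Context: For $\lambda>0$, $\mathrm{E}[\lambda]$ denotes the exponential distribution with parameter (rate) $\lambda$ on $[0,\infty)$, i.e. with density $\lambda \mathrm{e}^{-\lambda x}$, $x\geq 0$. The symbol $\ast$ denotes convolution of measures, and for $k\in\mathbb{N}=\{1,2,\ldots\}$, $\mathrm{E}^{\ast k}[\lambda]$ denotes the $k$-fold convolution of $\mathrm{E}[\lambda]$ with itself; thus $\mathrm{E}^{\ast 2(k+1)}[\lambda]$ is the $2(k+1)$-fold convolution. *)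

theory Defs
  imports "HOL-Probability.Probability"
begin

text \<open>The law is a Borel measure on the whole real line; the library density vanishes on the
  negative half-line, so this is the law on the half-line \<open>[0,\<infinity>)\<close>, viewed as a measure on the reals.\<close>

definition exponential_measure :: "real \<Rightarrow> real measure" where
  "exponential_measure l = density lborel (\<lambda>x. ennreal (exponential_density l x))"

text \<open>The zeroth power is the Dirac measure at 0, the neutral element of convolution, so that
  the first power is the measure itself (\<open>conv_power_1\<close> below).\<close>

primrec conv_power :: "real measure \<Rightarrow> nat \<Rightarrow> real measure" where
  "conv_power M 0 = return borel 0"
| "conv_power M (Suc k) = convolution M (conv_power M k)"

text \<open>The setwise sum of a sequence of measures, meant for sequences living on one common
  sigma-algebra (see \<open>emeasure_suminf_measure\<close> below).\<close>

definition suminf_measure :: "(nat \<Rightarrow> 'a measure) \<Rightarrow> 'a measure" where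
  "suminf_measure M = measure_of (space (M 0)) (sets (M 0)) (\<lambda>A. \<Sum>k. emeasure (M k) A)"

lemma sets_exponential_measure [simp, measurable_cong]:
  "sets (exponential_measure l) = sets borel"
  by (simp add: exponential_measure_def)

lemma prob_space_exponential_measure:
  "0 < l \<Longrightarrow> prob_space (exponential_measure l)"
  unfolding exponential_measure_def by (rule prob_space_exponential_density)

lemma prob_space_convolution:
  fixes M N :: "real measure"
  assumes "prob_space M" "prob_space N"
    and [measurable_cong]: "sets M = sets borel" "sets N = sets borel"
  shows "prob_space (convolution M N)"
proof -
  interpret M: prob_space M by fact
  interpret N: prob_space N by fact
  interpret pair_prob_space M N ..
  show ?thesis unfolding convolution_def by (rule prob_space_distr) measurable
qed

lemma sets_conv_power [simp, measurable_cong]: "sets (conv_power M k) = sets borel"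
  by (cases k) simp_all

lemma prob_space_conv_power:
  assumes "prob_space M" "sets M = sets borel"
  shows "prob_space (conv_power M k)"
  using assms by (induction k) (simp_all add: prob_space_return prob_space_convolution)

lemma conv_power_1:
  assumes "finite_measure M" and [measurable_cong]: "sets M = sets borel"
  shows "conv_power M 1 = M"
proof (rule measure_eqI)
  fix A assume "A \<in> sets (conv_power M 1)"
  then have A [measurable]: "A \<in> sets borel" by simp
  have "finite_measure (return borel (0::real))"
    by (intro prob_space.finite_measure prob_space_return) simp
  then have "emeasure (conv_power M 1) A
      = (\<integral>\<^sup>+x. \<integral>\<^sup>+y. indicator A (x + y) \<partial>return borel 0 \<partial>M)"
    using assms A by (simp add: convolution_emeasure')
  also have "\<dots> = (\<integral>\<^sup>+x. indicator A x \<partial>M)"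
    by (intro nn_integral_cong) (subst nn_integral_return, auto)
  also have "\<dots> = emeasure M A" by (simp add: assms)
  finally show "emeasure (conv_power M 1) A = emeasure M A" .
qed (simp add: assms)

lemma sets_suminf_measure [simp]: "sets (suminf_measure M) = sets (M 0)"
  by (simp add: suminf_measure_def)

lemma emeasure_suminf_measure:
  assumes "\<And>k. sets (M k) = sets (M 0)" "A \<in> sets (M 0)"
  shows "emeasure (suminf_measure M) A = (\<Sum>k. emeasure (M k) A)"
proof (rule emeasure_measure_of[OF suminf_measure_def])
  show "sets (M 0) \<subseteq> Pow (space (M 0))" by (rule sets.space_closed)
  show "A \<in> sets (suminf_measure M)" using assms by simp
  show "positive (sets (suminf_measure M)) (\<lambda>A. \<Sum>k. emeasure (M k) A)"
    by (simp add: positive_def)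
  show "countably_additive (sets (suminf_measure M)) (\<lambda>A. \<Sum>k. emeasure (M k) A)"
  proof (rule countably_additiveI)
    fix B :: "nat \<Rightarrow> 'a set"
    assume B: "range B \<subseteq> sets (suminf_measure M)" "disjoint_family B"
    have "(\<Sum>i. \<Sum>k. emeasure (M k) (B i)) = (\<Sum>k. \<Sum>i. emeasure (M k) (B i))"
    proof -
      have "pair_sigma_finite (count_space (UNIV :: nat set)) (count_space (UNIV :: nat set))"
        by (intro pair_sigma_finite.intro sigma_finite_measure_count_space)
      from pair_sigma_finite.Fubini'[OF this, of "\<lambda>i k. emeasure (M k) (B i)"] show ?thesis
        by (simp add: nn_integral_count_space_nat pair_measure_countable)
    qed
    also have "\<dots> = (\<Sum>k. emeasure (M k) (\<Union>i. B i))"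
    proof (intro suminf_cong suminf_emeasure)
      show "range B \<subseteq> sets (M k)" for k using B(1) assms(1)[of k] by simp
    qed (rule B(2))
    finally show "(\<Sum>i. \<Sum>k. emeasure (M k) (B i)) = (\<Sum>k. emeasure (M k) (\<Union>i. B i))" .
  qed
qed

end

theory Submission
  imports Defs
begin

text \<open>Every measure in the identity has a density with respect to Lebesgue measure, so it suffices to
  compare densities on the positive half-line. Put \<open>m = (l1 + l2) / 2\<close> and \<open>d = (l2 - l1) / 2\<close>, so that
  \<open>p = (d / m)\<^sup>2\<close> and \<open>(1 - p) m\<^sup>2 = l1 l2\<close>.

  The convolution of the two exponential laws has the density
  \<open>l1 l2 (exp (- l1 x) - exp (- l2 x)) / (l2 - l1)\<close> (\<open>convolution_exponential_measure\<close>). Taking out the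
  geometric mean \<open>exp (- m x)\<close> of the two exponentials leaves \<open>l1 l2 / d \<cdot> exp (- m x) sinh (d x)\<close>.
  On the other side, the even convolution powers are Erlang laws (\<open>conv_power_exponential_measure\<close>),
  whose densities \<open>m ^ (2k+2) x ^ (2k+1) exp (- m x) / (2k+1)!\<close> carry exactly the odd powers of \<open>x\<close>.
  The weight \<open>p ^ k\<close> turns all but two of the factors \<open>m\<close> into \<open>d\<close>, and the series becomes the
  power series of \<open>sinh (d x)\<close> (\<open>geometric_sum_erlang_density\<close>).\<close>

lemma convolution_exponential_density:
  assumes "0 < a" "0 < b" "a \<noteq> b"
  shows "(\<integral>\<^sup>+y. ennreal (exponential_density a (x - y)) * ennreal (exponential_density b y) \<partial>lborel)
    = ennreal (if x < 0 then 0 else a * b * (exp (- a * x) - exp (- b * x)) / (b - a))"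
proof (cases "x < 0")
  case True
  then have "ennreal (exponential_density a (x - y)) * ennreal (exponential_density b y) = 0" for y
    by (auto simp: exponential_density_def)
  then show ?thesis by (simp only: nn_integral_const) (simp add: True)
next
  case False
  then have x: "0 \<le> x" by simp
  \<comment> \<open>The integrand lives on \<open>[0, x]\<close>, where the product of the two exponentials is the single
      exponential \<open>f\<close> in \<open>y\<close>, with antiderivative \<open>F\<close> because \<open>a \<noteq> b\<close>.\<close>
  define F where "F y = a * b * exp (- a * x) * exp ((a - b) * y) / (a - b)" for y
  define f where "f y = a * b * exp (- a * x) * exp ((a - b) * y)" for y
  have "ennreal (exponential_density a (x - y)) * ennreal (exponential_density b y)
      = ennreal (f y) * indicator {0..x} y" for y
    using assms
    by (auto simp: exponential_density_def f_def indicator_def ennreal_mult'[symmetric]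
        exp_add[symmetric] algebra_simps)
  then have "(\<integral>\<^sup>+y. ennreal (exponential_density a (x - y)) * ennreal (exponential_density b y) \<partial>lborel)
      = (\<integral>\<^sup>+y. ennreal (f y) * indicator {0..x} y \<partial>lborel)"
    by simp
  also have "\<dots> = ennreal (F x - F 0)"
  proof (rule nn_integral_FTC_Icc[OF _ _ _ x])
    show "f \<in> borel_measurable borel" unfolding f_def by measurable
    show "DERIV F y :> f y" for y
      unfolding F_def f_def using assms by (auto intro!: derivative_eq_intros)
    show "0 \<le> f y" for y using assms by (simp add: f_def)
  qed
  also have "F x - F 0 = a * b * (exp (- a * x) - exp (- b * x)) / (b - a)"
  proof -
    have "exp (- a * x) * exp ((a - b) * x) = exp (- b * x)"
      by (subst exp_add[symmetric]) (simp add: algebra_simps)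
    then have "F x = a * b * exp (- b * x) / (a - b)"
      unfolding F_def by (simp only: mult.assoc)
    then have "F x - F 0 = a * b * (exp (- b * x) - exp (- a * x)) / (a - b)"
      by (simp add: F_def[of 0] diff_divide_distrib right_diff_distrib)
    also have "\<dots> = a * b * (exp (- a * x) - exp (- b * x)) / (b - a)"
      using minus_divide_divide[of "a * b * (exp (- b * x) - exp (- a * x))" "a - b"]
      by (simp only: minus_diff_eq mult_minus_right[symmetric])
    finally show ?thesis .
  qed
  finally show ?thesis using x by simp
qed

lemma convolution_exponential_measure:
  assumes "0 < a" "0 < b" "a \<noteq> b"
  shows "convolution (exponential_measure a) (exponential_measure b) = density lborel
    (\<lambda>x. ennreal (if x < 0 then 0 else a * b * (exp (- a * x) - exp (- b * x)) / (b - a)))"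
proof -
  have "convolution (exponential_measure a) (exponential_measure b) = density lborel
      (\<lambda>x. \<integral>\<^sup>+y. ennreal (exponential_density a (x - y)) * ennreal (exponential_density b y) \<partial>lborel)"
    unfolding exponential_measure_def using assms
    by (intro convolution_density)
      (auto intro!: prob_space.finite_measure prob_space_exponential_density)
  then show ?thesis by (simp only: convolution_exponential_density[OF assms])
qed

lemma conv_power_exponential_measure:
  assumes l: "0 < l"
  shows "conv_power (exponential_measure l) (Suc n) = density lborel (erlang_density n l)"
proof (induction n)
  case 0
  show ?case
    using conv_power_1[of "exponential_measure l"] l
    by (simp add: prob_space.finite_measure prob_space_exponential_measure)
      (simp add: exponential_measure_def)
next
  case (Suc n)
  have "conv_power (exponential_measure l) (Suc (Suc n))
      = convolution (density lborel (exponential_density l)) (density lborel (erlang_density n l))"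
    using Suc by (simp add: exponential_measure_def)
  also have "\<dots> = density lborel (\<lambda>x. \<integral>\<^sup>+y. ennreal (exponential_density l (x - y))
      * ennreal (erlang_density n l y) \<partial>lborel)"
    by (rule convolution_density)
      (use l in \<open>auto intro!: prob_space.finite_measure prob_space_erlang_density\<close>)
  also have "\<dots> = density lborel (erlang_density (Suc n) l)"
    using convolution_erlang_density[OF l, of 0 n] by simp
  finally show ?case .
qed

lemma scale_measure_density:
  assumes [measurable]: "f \<in> borel_measurable M"
  shows "scale_measure c (density M f) = density M (\<lambda>x. c * f x)"
  by (rule measure_eqI) (simp_all add: emeasure_density nn_integral_cmult mult.assoc)

lemma suminf_measure_density:
  assumes [measurable]: "\<And>k. f k \<in> borel_measurable M"
  shows "suminf_measure (\<lambda>k. density M (f k)) = density M (\<lambda>x. \<Sum>k. f k x)"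
proof (rule measure_eqI)
  fix A assume "A \<in> sets (suminf_measure (\<lambda>k. density M (f k)))"
  then have A [measurable]: "A \<in> sets M" by simp
  have "emeasure (suminf_measure (\<lambda>k. density M (f k))) A = (\<Sum>k. \<integral>\<^sup>+x. f k x * indicator A x \<partial>M)"
    by (subst emeasure_suminf_measure) (simp_all add: emeasure_density)
  also have "\<dots> = (\<integral>\<^sup>+x. (\<Sum>k. f k x * indicator A x) \<partial>M)"
    by (rule nn_integral_suminf[symmetric]) measurable
  finally show "emeasure (suminf_measure (\<lambda>k. density M (f k))) A
      = emeasure (density M (\<lambda>x. \<Sum>k. f k x)) A"
    by (simp add: emeasure_density)
qed simp

lemma sinh_odd_series: "(\<lambda>k. x ^ (2 * k + 1) / fact (2 * k + 1)) sums sinh (x :: real)"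
proof -
  let ?c = "\<lambda>n. if even n then 0 else x ^ n /\<^sub>R fact n"
  have "(\<lambda>k. ?c (2 * k + 1)) sums sinh x \<longleftrightarrow> ?c sums sinh x"
  proof (rule sums_mono_reindex)
    show "strict_mono (\<lambda>k. 2 * k + 1 :: nat)" by (simp add: strict_mono_def)
    show "?c n = 0" if "n \<notin> range (\<lambda>k. 2 * k + 1)" for n
      using that by (auto elim!: oddE)
  qed
  then show ?thesis using sinh_converges[of x] by (simp add: field_simps)
qed

text \<open>The weight \<open>q ^ (2k)\<close> and the factor \<open>m ^ (2k+2) x ^ (2k+1)\<close> of the Erlang density combine to
  \<open>(m / q) (q m x) ^ (2k+1)\<close>, so only the hyperbolic sine series remains.\<close>

lemma geometric_sum_erlang_density:
  assumes "0 < m" "0 < q" "0 \<le> x"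
  shows "(\<lambda>k. q\<^sup>2 ^ k * erlang_density (2 * k + 1) m x) sums (m / q * exp (- m * x) * sinh (q * m * x))"
proof -
  have "q\<^sup>2 ^ k * erlang_density (2 * k + 1) m x
      = m / q * exp (- m * x) * ((q * m * x) ^ (2 * k + 1) / fact (2 * k + 1))" for k
    using assms
    by (simp add: erlang_density_def power_mult[symmetric] power_mult_distrib field_simps
        del: fact_Suc)
  then show ?thesis
    using sums_mult[OF sinh_odd_series, of "m / q * exp (- m * x)" "q * m * x"] by simp
qed

theorem theorem3:
  fixes l1 l2 p :: real
  assumes "0 < l1" and "l1 < l2"
    and "p = ((l2 - l1) / (l2 + l1))\<^sup>2"
  shows "convolution (exponential_measure l1) (exponential_measure l2) =
    scale_measure (ennreal (1 - p))
      (suminf_measure (\<lambda>k. scale_measure (ennreal (p ^ k))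
        (conv_power (exponential_measure ((l2 + l1) / 2)) (2 * (k + 1)))))"
proof -
  define m where "m = (l2 + l1) / 2"
  define q where "q = (l2 - l1) / (l2 + l1)"
  have m: "0 < m" and q: "0 < q" and p: "p = q\<^sup>2" and qm: "q * m = (l2 - l1) / 2"
    using assms by (auto simp: m_def q_def)
  have p_compl: "1 - p = l1 * l2 / m\<^sup>2"
  proof -
    have "(l2 + l1)\<^sup>2 - (l2 - l1)\<^sup>2 = 4 * (l1 * l2)"
      by (simp add: power2_eq_square algebra_simps)
    then show ?thesis
      using assms by (simp add: m_def power_divide diff_divide_eq_iff)
  qed
  then have "0 \<le> 1 - p" using assms by simp
  have conv_pow: "conv_power (exponential_measure m) (2 * (k + 1))
      = density lborel (erlang_density (2 * k + 1) m)" for k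
    using conv_power_exponential_measure[OF m, of "2 * k + 1"] by simp
  have densities_agree: "ennreal (1 - p)
      * (\<Sum>k. ennreal (p ^ k) * ennreal (erlang_density (2 * k + 1) m x))
    = ennreal (if x < 0 then 0 else l1 * l2 * (exp (- l1 * x) - exp (- l2 * x)) / (l2 - l1))" for x
  proof (cases "x < 0")
    case True
    then show ?thesis by (simp add: erlang_density_def)
  next
    case False
    have "(\<Sum>k. ennreal (p ^ k) * ennreal (erlang_density (2 * k + 1) m x))
        = (\<Sum>k. ennreal (q\<^sup>2 ^ k * erlang_density (2 * k + 1) m x))"
      using m by (simp add: p ennreal_mult)
    also have "\<dots> = ennreal (m / q * exp (- m * x) * sinh (q * m * x))"
      using m q False geometric_sum_erlang_density[OF m q, of x]
      by (intro suminf_ennreal_eq) simp_all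
    finally have "ennreal (1 - p)
        * (\<Sum>k. ennreal (p ^ k) * ennreal (erlang_density (2 * k + 1) m x))
      = ennreal ((1 - p) * (m / q * exp (- m * x) * sinh (q * m * x)))"
      using \<open>0 \<le> 1 - p\<close> by (simp only: ennreal_mult')
    also have "(1 - p) * (m / q * exp (- m * x) * sinh (q * m * x))
        = l1 * l2 / (q * m) * (exp (- m * x) * sinh (q * m * x))"
      using m q unfolding p_compl by (simp add: power2_eq_square field_simps)
    also have "exp (- m * x) * sinh (q * m * x) = (exp (- l1 * x) - exp (- l2 * x)) / 2"
    proof -
      have "exp (- m * x) * sinh (q * m * x)
          = (exp (- m * x + q * m * x) - exp (- m * x + - (q * m * x))) / 2"
        unfolding exp_add by (simp add: sinh_field_def right_diff_distrib)
      moreover have "- m * x + q * m * x = - l1 * x" "- m * x + - (q * m * x) = - l2 * x"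
        unfolding qm by (simp_all add: m_def field_simps)
      ultimately show ?thesis by (simp only:)
    qed
    also have "l1 * l2 / (q * m) * ((exp (- l1 * x) - exp (- l2 * x)) / 2)
        = l1 * l2 * (exp (- l1 * x) - exp (- l2 * x)) / (l2 - l1)"
    proof -
      have "u / (v / 2) * (w / 2) = u * w / v" for u v w :: real by simp
      then show ?thesis unfolding qm .
    qed
    finally show ?thesis using False by (simp only: if_False)
  qed
  have "scale_measure (ennreal (1 - p)) (suminf_measure (\<lambda>k. scale_measure (ennreal (p ^ k))
      (conv_power (exponential_measure m) (2 * (k + 1)))))
    = density lborel (\<lambda>x. ennreal (1 - p)
      * (\<Sum>k. ennreal (p ^ k) * ennreal (erlang_density (2 * k + 1) m x)))"
    unfolding conv_pow by (simp add: scale_measure_density suminf_measure_density)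
  also have "\<dots> = convolution (exponential_measure l1) (exponential_measure l2)"
    unfolding densities_agree using assms by (simp add: convolution_exponential_measure)
  finally show ?thesis by (simp add: m_def)
qed

end
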